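(* Let $G$ be a finite simple connected graph that is $(3\text{-sun},C_4,C_5,C_6)$-free, i.e. contains no induced subgraph isomorphic to the $3$-sun, $C_4$, $C_5$ or $C_6$. Then $$\gamma_{\mathrm{os}}(\mathscr{P}_3(G))=\gamma_{R}(G)=\mathrm{we}(G^2)\le 2\chi(\overline{G^2}).$$
   Context: The $3$-sun is the graph obtained from the $6$-cycle $C_6$ by turning an independent set of size three into a clique. $G^2$ is the graph on $V(G)$ in which two distinct vertices are adjacent iff their distance in $G$ is at most $2$; $\overline{H}$ denotes the complement of a graph $H$, and $\chi(H)$ its chromatic number. For a poset $P=(X,\le)$, $\mathrm{Mid}(P)$ is the set of elements that are neither maximal nor minimal. The comparability graph $\mathrm{Comp}(P)$ has vertex set $X$, with $x\neq y$ adjacent iff $x<y$ or $y<x$. A dominating set of a graph is a set $S$ of vertices such that every vertex not in $S$ has a neighbor in $S$. An order-sensitive dominating set of $P$ is a dominating set $D$ of $\mathrm{Comp}(P)$ such that for every $x\in\mathrm{Mid}(P)$, either $x\in D$ or there are $a,b\in D$ with $a<x<b$. $\gamma_{\mathrm{os}}(P)$ is the minimum size of an order-sensitive dominating set of $P$. For a graph $G$ on vertex set $[n]=\{1,\dots,n\}$, $\mathscr{P}_3(G)$ is the graded poset with ground set $\{x_{(l,i)} : l\in\{1,2,3\},\ i\in[n]\}$ whose covering relations are: for $r\in\{1,2\}$ and $i,j\in[n]$, $x_{(r,i)}\prec x_{(r+1,j)}$ iff $i=j$ or $ij\in E(G)$. A Roman dominating function of $G$ is a function $f:V(G)\to\{0,1,2\}$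 such that every vertex $v$ with $f(v)=0$ has a neighbor $u$ with $f(u)=2$; its weight is $\sum_{v}f(v)$. $\gamma_R(G)$ is the minimum weight of a Roman dominating function of $G$. For a graph $H$, the weight of a non-empty clique $C$ is $\mathrm{we}(C)=1$ if $|C|=1$ and $\mathrm{we}(C)=2$ if $|C|\ge2$. A clique partition $\mathcal{C}=\{C_1,\dots,C_m\}$ of $H$ is a partition of $V(H)$ into non-empty cliques, of weight $\mathrm{we}(\mathcal{C})=\sum_i\mathrm{we}(C_i)$. The weighted clique partition number $\mathrm{we}(H)$ is the minimum weight of a clique partition of $H$. *)

theory Defs
  imports "Graph_Theory.Graph_Theory" "HOL-Library.Disjoint_Sets"
begin

text \<open>
  A finite simple graph is a \<^locale>\<open>pair_graph\<close>: a finite vertex set with an irreflexive,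
  symmetric set of arcs, so each undirected edge is represented by its two orientations.
  A poset is given by its ground set \<^term>\<open>X\<close> and its reflexive order relation \<^term>\<open>r\<close>
  on \<^term>\<open>X\<close>.
\<close>

definition cycle_graph :: "nat \<Rightarrow> nat pair_pre_digraph" where
  "cycle_graph n = \<lparr> pverts = {..<n},
     parcs = {(i, j). i < n \<and> j < n \<and> (j = (i + 1) mod n \<or> i = (j + 1) mod n)} \<rparr>"

definition three_sun :: "nat pair_pre_digraph" where
  "three_sun = \<lparr> pverts = pverts (cycle_graph 6),
     parcs = parcs (cycle_graph 6) \<union> {(i, j). i \<in> {0, 2, 4} \<and> j \<in> {0, 2, 4} \<and> i \<noteq> j} \<rparr>"

definition has_induced :: "'a pair_pre_digraph \<Rightarrow> 'b pair_pre_digraph \<Rightarrow> bool" where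
  "has_induced G H \<longleftrightarrow>
     (\<exists>S. induced_subgraph (with_proj S) (with_proj G) \<and> digraph_iso (with_proj H) (with_proj S))"

definition graph_dist :: "'a pair_pre_digraph \<Rightarrow> 'a \<Rightarrow> 'a \<Rightarrow> ereal" where
  "graph_dist G u v = wf_digraph.\<mu> (with_proj G) (\<lambda>_. 1) u v"

definition graph_square :: "'a pair_pre_digraph \<Rightarrow> 'a pair_pre_digraph" where
  "graph_square G = \<lparr> pverts = pverts G,
     parcs = {(u, v). u \<in> pverts G \<and> v \<in> pverts G \<and> u \<noteq> v \<and> graph_dist G u v \<le> 2} \<rparr>"

definition graph_complement :: "'a pair_pre_digraph \<Rightarrow> 'a pair_pre_digraph" where
  "graph_complement H = \<lparr> pverts = pverts H,
     parcs = {(u, v). u \<in> pverts H \<and> v \<in> pverts H \<and> u \<noteq> v \<and> (u, v) \<notin> parcs H} \<rparr>"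

definition proper_coloring :: "'a pair_pre_digraph \<Rightarrow> nat \<Rightarrow> ('a \<Rightarrow> nat) \<Rightarrow> bool" where
  "proper_coloring H k c \<longleftrightarrow>
     (\<forall>v \<in> pverts H. c v < k) \<and> (\<forall>(u, v) \<in> parcs H. c u \<noteq> c v)"

definition chromatic_number :: "'a pair_pre_digraph \<Rightarrow> nat" where
  "chromatic_number H = (LEAST k. \<exists>c. proper_coloring H k c)"

definition dominating_set :: "'a pair_pre_digraph \<Rightarrow> 'a set \<Rightarrow> bool" where
  "dominating_set H S \<longleftrightarrow>
     S \<subseteq> pverts H \<and> (\<forall>v \<in> pverts H - S. \<exists>u \<in> S. (v, u) \<in> parcs H)"

definition roman_dominating :: "'a pair_pre_digraph \<Rightarrow> ('a \<Rightarrow> nat) \<Rightarrow> bool" where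
  "roman_dominating G f \<longleftrightarrow> f ` pverts G \<subseteq> {0, 1, 2} \<and>
     (\<forall>v \<in> pverts G. f v = 0 \<longrightarrow> (\<exists>u \<in> pverts G. (v, u) \<in> parcs G \<and> f u = 2))"

definition roman_domination_number :: "'a pair_pre_digraph \<Rightarrow> nat" where
  "roman_domination_number G = (LEAST w. \<exists>f. roman_dominating G f \<and> (\<Sum>v \<in> pverts G. f v) = w)"

definition clique :: "'a pair_pre_digraph \<Rightarrow> 'a set \<Rightarrow> bool" where
  "clique H C \<longleftrightarrow> C \<subseteq> pverts H \<and> (\<forall>u \<in> C. \<forall>v \<in> C. u \<noteq> v \<longrightarrow> (u, v) \<in> parcs H)"

definition clique_partition :: "'a pair_pre_digraph \<Rightarrow> 'a set set \<Rightarrow> bool" where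
  "clique_partition H \<C> \<longleftrightarrow> partition_on (pverts H) \<C> \<and> (\<forall>C \<in> \<C>. clique H C)"

definition clique_weight :: "'a set \<Rightarrow> nat" where
  "clique_weight C = (if card C = 1 then 1 else 2)"

definition weighted_clique_partition_number :: "'a pair_pre_digraph \<Rightarrow> nat" where
  "weighted_clique_partition_number H =
     (LEAST w. \<exists>\<C>. clique_partition H \<C> \<and> (\<Sum>C \<in> \<C>. clique_weight C) = w)"

definition strictly_below :: "'a rel \<Rightarrow> 'a \<Rightarrow> 'a \<Rightarrow> bool" where
  "strictly_below r x y \<longleftrightarrow> (x, y) \<in> r \<and> x \<noteq> y"

definition minimal_elements :: "'a set \<Rightarrow> 'a rel \<Rightarrow> 'a set" where
  "minimal_elements X r = {x \<in> X. \<not> (\<exists>y \<in> X. strictly_below r y x)}"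

definition maximal_elements :: "'a set \<Rightarrow> 'a rel \<Rightarrow> 'a set" where
  "maximal_elements X r = {x \<in> X. \<not> (\<exists>y \<in> X. strictly_below r x y)}"

definition Mid :: "'a set \<Rightarrow> 'a rel \<Rightarrow> 'a set" where
  "Mid X r = X - (minimal_elements X r \<union> maximal_elements X r)"

definition Comp :: "'a set \<Rightarrow> 'a rel \<Rightarrow> 'a pair_pre_digraph" where
  "Comp X r = \<lparr> pverts = X,
     parcs = {(x, y). x \<in> X \<and> y \<in> X \<and> (strictly_below r x y \<or> strictly_below r y x)} \<rparr>"

definition order_sensitive_dominating_set :: "'a set \<Rightarrow> 'a rel \<Rightarrow> 'a set \<Rightarrow> bool" where
  "order_sensitive_dominating_set X r D \<longleftrightarrow> dominating_set (Comp X r) D \<and>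
     (\<forall>x \<in> Mid X r. x \<in> D \<or> (\<exists>a \<in> D. \<exists>b \<in> D. strictly_below r a x \<and> strictly_below r x b))"

definition gamma_os :: "'a set \<Rightarrow> 'a rel \<Rightarrow> nat" where
  "gamma_os X r =
     (LEAST k. \<exists>D. finite D \<and> order_sensitive_dominating_set X r D \<and> card D = k)"

definition P3_ground :: "'a pair_pre_digraph \<Rightarrow> (nat \<times> 'a) set" where
  "P3_ground G = {1, 2, 3} \<times> pverts G"

definition P3_cover :: "'a pair_pre_digraph \<Rightarrow> (nat \<times> 'a) rel" where
  "P3_cover G = {((l, i), (l + 1, j)) | l i j.
     l \<in> {1, 2} \<and> i \<in> pverts G \<and> j \<in> pverts G \<and> (i = j \<or> (i, j) \<in> parcs G)}"

text \<open>
  The element \<open>x\<^bsub>(l,i)\<^esub>\<close> is \<open>(l, i)\<close>. The covering relations are given, so the order is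
  the one they generate; \<open>P3_covering_relation\<close> below shows that no cover is gained or lost.
\<close>

definition P3_le :: "'a pair_pre_digraph \<Rightarrow> (nat \<times> 'a) rel" where
  "P3_le G = Restr ((P3_cover G)\<^sup>*) (P3_ground G)"

lemma P3_cover_level: "(x, y) \<in> P3_cover G \<Longrightarrow> fst y = Suc (fst x)"
  by (auto simp: P3_cover_def)

lemma P3_cover_ground: "(x, y) \<in> P3_cover G \<Longrightarrow> x \<in> P3_ground G \<and> y \<in> P3_ground G"
  by (auto simp: P3_cover_def P3_ground_def)

lemma P3_cover_rtrancl_level:
  "(x, y) \<in> (P3_cover G)\<^sup>* \<Longrightarrow> x = y \<or> fst x < fst y"
  by (induction rule: rtrancl_induct) (auto dest: P3_cover_level)

lemma P3_partial_order: "partial_order_on (P3_ground G) (P3_le G)"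
proof -
  have "refl_on (P3_ground G) (P3_le G)" by (auto simp: refl_on_def P3_le_def)
  moreover have "trans (P3_le G)" by (auto simp: trans_def P3_le_def intro: rtrancl_trans)
  moreover have "antisym (P3_le G)"
    by (fastforce simp: antisym_def P3_le_def dest: P3_cover_rtrancl_level)
  ultimately show ?thesis
    by (auto simp: partial_order_on_def preorder_on_def P3_le_def)
qed

lemma P3_covering_relation:
  "(x, y) \<in> P3_cover G \<longleftrightarrow> strictly_below (P3_le G) x y \<and>
     \<not> (\<exists>z \<in> P3_ground G. strictly_below (P3_le G) x z \<and> strictly_below (P3_le G) z y)"
    (is "?L \<longleftrightarrow> ?R")
proof
  assume xy: ?L
  have "strictly_below (P3_le G) x y"
    using xy P3_cover_ground[OF xy] P3_cover_level[OF xy]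
    by (auto simp: strictly_below_def P3_le_def)
  moreover have "\<not> (strictly_below (P3_le G) x z \<and> strictly_below (P3_le G) z y)" for z
    using P3_cover_level[OF xy] P3_cover_rtrancl_level[of x z G] P3_cover_rtrancl_level[of z y G]
    by (auto simp: strictly_below_def P3_le_def)
  ultimately show ?R by blast
next
  assume R: ?R
  then have "(x, y) \<in> (P3_cover G)\<^sup>*" "x \<noteq> y" and g: "y \<in> P3_ground G"
    by (auto simp: strictly_below_def P3_le_def)
  then obtain z where z: "(x, z) \<in> P3_cover G" "(z, y) \<in> (P3_cover G)\<^sup>*"
    by (meson converse_rtranclE)
  have "strictly_below (P3_le G) x z"
    using z(1) P3_cover_ground[OF z(1)] P3_cover_level[OF z(1)]
    by (auto simp: strictly_below_def P3_le_def)
  moreover have "z \<noteq> y \<Longrightarrow> strictly_below (P3_le G) z y"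
    using z P3_cover_ground[OF z(1)] g by (auto simp: strictly_below_def P3_le_def)
  ultimately have "z = y" using R P3_cover_ground[OF z(1)] by blast
  with z show ?L by simp
qed

end

theory Submission
  imports Defs
begin

text \<open>
  The first equality holds for every graph. A Roman dominating function \<open>f\<close> yields the
  order-sensitive dominating set with \<open>x\<^bsub>(2,v)\<^esub>\<close> where \<open>f v = 1\<close> and both
  \<open>x\<^bsub>(1,v)\<^esub>\<close>, \<open>x\<^bsub>(3,v)\<^esub>\<close> where \<open>f v = 2\<close>. Conversely, a vertex whose middle copy is
  missing is dominated both from the bottom and from the top level, so the value 2 may be placed
  on the smaller of these two levels.

  For the second equality, the vertices with a common dominator of value 2 form a clique of
  \<open>G\<^sup>2\<close>. For the converse, every clique of \<open>G\<^sup>2\<close> must lie in one closed neighbourhood, that is,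
  closed neighbourhoods have the Helly property. If \<open>x\<^sub>1, x\<^sub>2, x\<^sub>3\<close> and \<open>v\<^sub>1, v\<^sub>2, v\<^sub>3\<close> are such that
  \<open>x\<^sub>i\<close> sees \<open>v\<^sub>j\<close> for \<open>i \<noteq> j\<close> but not for \<open>i = j\<close>, they span a hexagon without long chords, and
  each choice of short chords produces an induced \<open>C\<^sub>4\<close>, \<open>C\<^sub>5\<close>, \<open>C\<^sub>6\<close> or 3-sun.
\<close>

text \<open>Covers of the poset, domination and distance at most 2 all reduce to closed
  neighbourhoods. Membership in the vertex set is built in, so every such fact also supplies its
  vertices.\<close>

definition closed_adj :: "'a pair_pre_digraph \<Rightarrow> 'a \<Rightarrow> 'a \<Rightarrow> bool" where
  "closed_adj G u v \<longleftrightarrow> u \<in> pverts G \<and> v \<in> pverts G \<and> (u = v \<or> (u, v) \<in> parcs G)"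

lemma closed_adj_refl: "u \<in> pverts G \<Longrightarrow> closed_adj G u u"
  by (simp add: closed_adj_def)

lemma (in pair_graph) parcs_sym: "(u, v) \<in> parcs G \<Longrightarrow> (v, u) \<in> parcs G"
  using pair_sym_arcs by (auto simp: symmetric_def dest: symD)

lemma (in pair_graph) closed_adj_sym: "closed_adj G u v \<Longrightarrow> closed_adj G v u"
  by (auto simp: closed_adj_def dest: parcs_sym)

lemma (in pair_graph) parcs_iff_closed_adj: "(u, v) \<in> parcs G \<longleftrightarrow> closed_adj G u v \<and> u \<noteq> v"
  using pair_no_loops by (fastforce simp: closed_adj_def dest: in_arcsD1 in_arcsD2)

section \<open>Induced subgraphs\<close>

text \<open>The witness is the subgraph of \<open>G\<close> induced on the image of
  \<open>f\<close>. Arcs are pairs of vertices, so the arc part of the isomorphism is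
  \<open>map_prod f f\<close>.\<close>

lemma (in pair_wf_digraph) has_inducedI:
  assumes wf: "parcs H \<subseteq> pverts H \<times> pverts H"
    and inj: "inj_on f (pverts H)"
    and f: "f ` pverts H \<subseteq> pverts G"
    and arcs: "\<And>u v. u \<in> pverts H \<Longrightarrow> v \<in> pverts H \<Longrightarrow> (u, v) \<in> parcs H \<longleftrightarrow> (f u, f v) \<in> parcs G"
  shows "has_induced G H"
proof -
  define S where
    "S = \<lparr> pverts = f ` pverts H, parcs = parcs G \<inter> (f ` pverts H) \<times> (f ` pverts H) \<rparr>"
  have "induced_subgraph (with_proj S) (with_proj G)"
    using f wf_digraph_axioms
    by (fastforce simp: induced_subgraph_def subgraph_def compatible_def wf_digraph_def S_def)
  moreover have "digraph_iso (with_proj H) (with_proj S)"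
    unfolding digraph_iso_def
  proof (intro exI conjI)
    let ?h = "\<lparr> iso_verts = f, iso_arcs = map_prod f f, iso_head = snd, iso_tail = fst \<rparr>"
    have "inj_on (map_prod f f) (parcs H)"
      using map_prod_inj_on[OF inj inj] wf by (rule inj_on_subset)
    then show "pre_digraph.digraph_isomorphism (with_proj H) ?h"
      using wf inj by (auto simp: pre_digraph.digraph_isomorphism_def wf_digraph_def)
    have "map_prod f f ` parcs H = parcs G \<inter> (f ` pverts H) \<times> (f ` pverts H)"
    proof
      show "map_prod f f ` parcs H \<subseteq> parcs G \<inter> (f ` pverts H) \<times> (f ` pverts H)"
        using wf arcs by auto
      show "parcs G \<inter> (f ` pverts H) \<times> (f ` pverts H) \<subseteq> map_prod f f ` parcs H"
        using arcs by (force simp: image_iff map_prod_def)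
    qed
    then show "with_proj S = app_iso ?h (with_proj H)"
      by (simp add: with_proj_def app_iso_def S_def)
  qed
  ultimately show ?thesis unfolding has_induced_def by blast
qed

text \<open>Listing the vertices turns an induced copy into finitely many checks, one for each pair
  of positions \<open>i < j\<close>. Symmetry and irreflexivity settle the other pairs, and
  distinctness lets closed adjacency stand for adjacency.\<close>

lemma (in pair_graph) has_induced_listI:
  assumes H: "pverts H = {..<length xs}" "parcs H \<subseteq> pverts H \<times> pverts H"
      "sym (parcs H)" "irrefl (parcs H)"
    and xs: "set xs \<subseteq> pverts G" "distinct xs"
    and adj: "\<forall>j<length xs. \<forall>i<j. closed_adj G (xs ! i) (xs ! j) \<longleftrightarrow> (i, j) \<in> parcs H"
  shows "has_induced G H"
proof (rule has_inducedI[where f = "(!) xs"])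
  show "inj_on ((!) xs) (pverts H)" using xs H by (simp add: inj_on_nth)
  show "(!) xs ` pverts H \<subseteq> pverts G" using xs H by auto
  show "(i, j) \<in> parcs H \<longleftrightarrow> (xs ! i, xs ! j) \<in> parcs G"
    if "i \<in> pverts H" "j \<in> pverts H" for i j
  proof -
    have *: "(i, j) \<in> parcs H \<longleftrightarrow> (xs ! i, xs ! j) \<in> parcs G" if "i < j" "j < length xs" for i j
      using that xs adj by (simp add: parcs_iff_closed_adj nth_eq_iff_index_eq)
    consider "i < j" | "j < i" | "i = j" by linarith
    then show ?thesis
    proof cases
      case 1
      then show ?thesis using * that H by simp
    next
      case 2
      then have "(j, i) \<in> parcs H \<longleftrightarrow> (xs ! j, xs ! i) \<in> parcs G" using * that H by simp
      then show ?thesis using H(3) parcs_sym by (meson symE)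
    next
      case 3
      then show ?thesis using H(4) by (simp add: irrefl_def parcs_iff_closed_adj)
    qed
  qed
qed (rule H)

section \<open>The forbidden graphs and the chords that their exclusion forces\<close>

lemma sym_cycle_graph: "sym (parcs (cycle_graph n))"
  by (auto simp: cycle_graph_def sym_def)

text \<open>For \<open>n = 1\<close> the successor of 0 modulo \<open>n\<close> is 0 itself, which
  would be a loop.\<close>

lemma irrefl_cycle_graph: "2 \<le> n \<Longrightarrow> irrefl (parcs (cycle_graph n))"
  by (auto simp: cycle_graph_def irrefl_def mod_Suc split: if_splits)

lemma pverts_cycle_graph [simp]: "pverts (cycle_graph n) = {..<n}"
  by (simp add: cycle_graph_def)

lemma parcs_cycle_graph_subset: "parcs (cycle_graph n) \<subseteq> {..<n} \<times> {..<n}"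
  by (auto simp: cycle_graph_def)

text \<open>For \<open>i < j\<close> the only edge that wraps around joins \<open>0\<close> to
  \<open>n - 1\<close>. This form has no arithmetic modulo \<open>n\<close>, so concrete cycles can
  be checked by simplification.\<close>

lemma parcs_cycle_graph_iff:
  "i < j \<Longrightarrow> (i, j) \<in> parcs (cycle_graph n) \<longleftrightarrow> j < n \<and> (j = Suc i \<or> i = 0 \<and> Suc j = n)"
  by (auto simp: cycle_graph_def mod_Suc)

lemma sym_three_sun: "sym (parcs three_sun)"
  using sym_cycle_graph[of 6] by (auto simp: three_sun_def sym_def)

lemma irrefl_three_sun: "irrefl (parcs three_sun)"
  using irrefl_cycle_graph[of 6] by (auto simp: three_sun_def irrefl_def)

lemma parcs_three_sun_subset: "parcs three_sun \<subseteq> pverts three_sun \<times> pverts three_sun"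
  using parcs_cycle_graph_subset[of 6] by (auto simp: three_sun_def)

text \<open>
  Stated for closed adjacency, these exclusions also cover cyclic sequences with repeated vertices.
\<close>

lemma (in pair_graph) C4_free_diagonal:
  assumes "\<not> has_induced G (cycle_graph 4)"
    and e: "closed_adj G a b" "closed_adj G b c" "closed_adj G c d" "closed_adj G d a"
  shows "closed_adj G a c \<or> closed_adj G b d"
proof (rule ccontr)
  assume n: "\<not> ?thesis"
  have V: "set [a, b, c, d] \<subseteq> pverts G" using e by (simp add: closed_adj_def)
  have r: "\<forall>x\<in>set [a, b, c, d]. closed_adj G x x" using V by (auto intro: closed_adj_refl)
  note s = e[THEN closed_adj_sym]
  have n': "\<not> closed_adj G a c" "\<not> closed_adj G c a" "\<not> closed_adj G b d" "\<not> closed_adj G d b"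
    using n by (auto dest: closed_adj_sym)
  \<comment> \<open>If two opposite entries were equal, reflexivity would give the missing diagonal.
    If two neighbouring ones were equal, an edge of the cycle would become a diagonal.\<close>
  have d: "distinct [a, b, c, d]"
    by (simp, intro conjI notI) (use e s n' r in \<open>simp_all\<close>)
  have "has_induced G (cycle_graph 4)"
    by (rule has_induced_listI[OF _ _ sym_cycle_graph irrefl_cycle_graph V d])
      (simp_all add: parcs_cycle_graph_subset parcs_cycle_graph_iff All_less_Suc numeral_eq_Suc e s n')
  with assms show False by blast
qed

lemma (in pair_graph) C5_free_chord:
  assumes "\<not> has_induced G (cycle_graph 5)"
    and e: "closed_adj G a b" "closed_adj G b c" "closed_adj G c d" "closed_adj G d e"
      "closed_adj G e a"
  shows "closed_adj G a c \<or> closed_adj G a d \<or> closed_adj G b d \<or> closed_adj G b e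
    \<or> closed_adj G c e"
proof (rule ccontr)
  assume n: "\<not> ?thesis"
  have V: "set [a, b, c, d, e] \<subseteq> pverts G" using e by (simp add: closed_adj_def)
  have r: "\<forall>x\<in>set [a, b, c, d, e]. closed_adj G x x" using V by (auto intro: closed_adj_refl)
  note s = e[THEN closed_adj_sym]
  have n': "\<not> closed_adj G a c" "\<not> closed_adj G c a" "\<not> closed_adj G a d" "\<not> closed_adj G d a"
    "\<not> closed_adj G b d" "\<not> closed_adj G d b" "\<not> closed_adj G b e" "\<not> closed_adj G e b"
    "\<not> closed_adj G c e" "\<not> closed_adj G e c"
    using n by (auto dest: closed_adj_sym)
  have d: "distinct [a, b, c, d, e]"
    by (simp, intro conjI notI) (use e s n' r in \<open>simp_all\<close>)
  have "has_induced G (cycle_graph 5)"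
    by (rule has_induced_listI[OF _ _ sym_cycle_graph irrefl_cycle_graph V d])
      (simp_all add: parcs_cycle_graph_subset parcs_cycle_graph_iff All_less_Suc numeral_eq_Suc e s n')
  with assms show False by blast
qed

lemma (in pair_graph) C6_free_chord:
  assumes "\<not> has_induced G (cycle_graph 6)"
    and e: "closed_adj G a b" "closed_adj G b c" "closed_adj G c d" "closed_adj G d e"
      "closed_adj G e f" "closed_adj G f a"
  shows "closed_adj G a c \<or> closed_adj G a d \<or> closed_adj G a e \<or> closed_adj G b d
    \<or> closed_adj G b e \<or> closed_adj G b f \<or> closed_adj G c e \<or> closed_adj G c f
    \<or> closed_adj G d f"
proof (rule ccontr)
  assume n: "\<not> ?thesis"
  have V: "set [a, b, c, d, e, f] \<subseteq> pverts G" using e by (simp add: closed_adj_def)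
  have r: "\<forall>x\<in>set [a, b, c, d, e, f]. closed_adj G x x" using V by (auto intro: closed_adj_refl)
  note s = e[THEN closed_adj_sym]
  have n': "\<not> closed_adj G a c" "\<not> closed_adj G c a" "\<not> closed_adj G a d" "\<not> closed_adj G d a"
    "\<not> closed_adj G a e" "\<not> closed_adj G e a" "\<not> closed_adj G b d" "\<not> closed_adj G d b"
    "\<not> closed_adj G b e" "\<not> closed_adj G e b" "\<not> closed_adj G b f" "\<not> closed_adj G f b"
    "\<not> closed_adj G c e" "\<not> closed_adj G e c" "\<not> closed_adj G c f" "\<not> closed_adj G f c"
    "\<not> closed_adj G d f" "\<not> closed_adj G f d"
    using n by (auto dest: closed_adj_sym)
  have d: "distinct [a, b, c, d, e, f]"
    by (simp, intro conjI notI) (use e s n' r in \<open>simp_all\<close>)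
  have "has_induced G (cycle_graph 6)"
    by (rule has_induced_listI[OF _ _ sym_cycle_graph irrefl_cycle_graph V d])
      (simp_all add: parcs_cycle_graph_subset parcs_cycle_graph_iff All_less_Suc numeral_eq_Suc e s n')
  with assms show False by blast
qed

lemma (in pair_graph) three_sun_free_chord:
  assumes "\<not> has_induced G three_sun"
    and e: "closed_adj G a b" "closed_adj G b c" "closed_adj G c d" "closed_adj G d e"
      "closed_adj G e f" "closed_adj G f a" "closed_adj G a c" "closed_adj G c e"
      "closed_adj G a e"
  shows "closed_adj G a d \<or> closed_adj G b d \<or> closed_adj G b e \<or> closed_adj G b f
    \<or> closed_adj G c f \<or> closed_adj G d f"
proof (rule ccontr)
  assume n: "\<not> ?thesis"
  have V: "set [a, b, c, d, e, f] \<subseteq> pverts G" using e by (simp add: closed_adj_def)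
  have r: "\<forall>x\<in>set [a, b, c, d, e, f]. closed_adj G x x" using V by (auto intro: closed_adj_refl)
  note s = e[THEN closed_adj_sym]
  have n': "\<not> closed_adj G a d" "\<not> closed_adj G d a" "\<not> closed_adj G b d" "\<not> closed_adj G d b"
    "\<not> closed_adj G b e" "\<not> closed_adj G e b" "\<not> closed_adj G b f" "\<not> closed_adj G f b"
    "\<not> closed_adj G c f" "\<not> closed_adj G f c" "\<not> closed_adj G d f" "\<not> closed_adj G f d"
    using n by (auto dest: closed_adj_sym)
  have d: "distinct [a, b, c, d, e, f]"
    by (simp, intro conjI notI) (use e s n' r in \<open>simp_all\<close>)
  have "has_induced G three_sun"
    by (rule has_induced_listI[OF _ _ sym_three_sun irrefl_three_sun V d])
      (rule parcs_three_sun_subset | simp add: three_sun_def parcs_cycle_graph_iff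
        All_less_Suc numeral_eq_Suc e s n')+
  with assms show False by blast
qed

section \<open>Cliques of the square\<close>

lemma (in pair_graph) closed_adj_triple:
  assumes sun: "\<not> has_induced G three_sun"
    and C4: "\<not> has_induced G (cycle_graph 4)"
    and C5: "\<not> has_induced G (cycle_graph 5)"
    and C6: "\<not> has_induced G (cycle_graph 6)"
    and e: "closed_adj G x1 v2" "closed_adj G x1 v3" "closed_adj G x2 v1" "closed_adj G x2 v3"
      "closed_adj G x3 v1" "closed_adj G x3 v2"
  shows "closed_adj G x1 v1 \<or> closed_adj G x2 v2 \<or> closed_adj G x3 v3"
proof (rule ccontr)
  assume n: "\<not> ?thesis"
  note s = e[THEN closed_adj_sym]
  have n': "\<not> closed_adj G x1 v1" "\<not> closed_adj G x2 v2" "\<not> closed_adj G x3 v3"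
    "\<not> closed_adj G v1 x1" "\<not> closed_adj G v2 x2" "\<not> closed_adj G v3 x3"
    using n by (auto dest: closed_adj_sym)
  note sym = closed_adj_sym
  note C4' = C4_free_diagonal[OF C4] and C5' = C5_free_chord[OF C5]
  \<comment> \<open>The hexagon is \<open>x1 v3 x2 v1 x3 v2\<close>, and its short chords form one
    triangle on the \<open>x\<close>s and one on the \<open>v\<close>s. Chords with the same two
    indices in both triangles would close a 4-cycle whose diagonals are long chords.\<close>
  have x: "\<not> (closed_adj G x1 x2 \<and> closed_adj G v1 v2)"
    "\<not> (closed_adj G x1 x3 \<and> closed_adj G v1 v3)"
    "\<not> (closed_adj G x2 x3 \<and> closed_adj G v2 v3)"
    using C4'[of x1 x2 v1 v2] C4'[of x1 x3 v1 v3] C4'[of x2 x3 v2 v3] e s n' sym by metis+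
  \<comment> \<open>No chord is alone in its triangle: it cuts off a 5-cycle in which the long
    chords are absent and the parallel chord is excluded by \<open>x\<close>.\<close>
  have p: "closed_adj G x1 x2 \<Longrightarrow> closed_adj G x1 x3 \<or> closed_adj G x2 x3"
    "closed_adj G x1 x3 \<Longrightarrow> closed_adj G x1 x2 \<or> closed_adj G x2 x3"
    "closed_adj G x2 x3 \<Longrightarrow> closed_adj G x1 x2 \<or> closed_adj G x1 x3"
    "closed_adj G v1 v2 \<Longrightarrow> closed_adj G v1 v3 \<or> closed_adj G v2 v3"
    "closed_adj G v1 v3 \<Longrightarrow> closed_adj G v1 v2 \<or> closed_adj G v2 v3"
    "closed_adj G v2 v3 \<Longrightarrow> closed_adj G v1 v2 \<or> closed_adj G v1 v3"
    using C5'[of x1 x2 v1 x3 v2] C5'[of x1 x3 v1 x2 v3] C5'[of x2 x3 v2 x1 v3]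
      C5'[of v1 v2 x1 v3 x2] C5'[of v1 v3 x1 v2 x3] C5'[of v2 v3 x2 v1 x3] e s n' sym x
    by metis+
  \<comment> \<open>Two chords of a triangle force the third: they lie on a 4-cycle whose other
    diagonal is a long chord.\<close>
  have q: "closed_adj G x1 x2 \<and> closed_adj G x1 x3 \<Longrightarrow> closed_adj G x2 x3"
    "closed_adj G x1 x2 \<and> closed_adj G x2 x3 \<Longrightarrow> closed_adj G x1 x3"
    "closed_adj G x1 x3 \<and> closed_adj G x2 x3 \<Longrightarrow> closed_adj G x1 x2"
    "closed_adj G v1 v2 \<and> closed_adj G v1 v3 \<Longrightarrow> closed_adj G v2 v3"
    "closed_adj G v1 v2 \<and> closed_adj G v2 v3 \<Longrightarrow> closed_adj G v1 v3"
    "closed_adj G v1 v3 \<and> closed_adj G v2 v3 \<Longrightarrow> closed_adj G v1 v2"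
    using C4'[of x1 x2 v1 x3] C4'[of x2 x1 v2 x3] C4'[of x3 x1 v3 x2]
      C4'[of v1 v2 x1 v3] C4'[of v2 v1 x2 v3] C4'[of v3 v1 x3 v2] e s n' sym
    by metis+
  \<comment> \<open>By \<open>p\<close> and \<open>q\<close> each triangle is complete or empty, and
    by \<open>x\<close> not both are complete. What remains is a 3-sun centred on the
    \<open>x\<close>s, one centred on the \<open>v\<close>s, or a chordless hexagon.\<close>
  consider "closed_adj G x1 x2" "closed_adj G x1 x3" "closed_adj G x2 x3"
      "\<not> closed_adj G v1 v2" "\<not> closed_adj G v1 v3" "\<not> closed_adj G v2 v3"
    | "closed_adj G v1 v2" "closed_adj G v1 v3" "closed_adj G v2 v3"
      "\<not> closed_adj G x1 x2" "\<not> closed_adj G x1 x3" "\<not> closed_adj G x2 x3"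
    | "\<not> closed_adj G v1 v2" "\<not> closed_adj G v1 v3" "\<not> closed_adj G v2 v3"
      "\<not> closed_adj G x1 x2" "\<not> closed_adj G x1 x3" "\<not> closed_adj G x2 x3"
    using x p q by argo
  then show False
  proof cases
    case 1
    then show False using three_sun_free_chord[OF sun, of x1 v3 x2 v1 x3 v2] e s n' sym by metis
  next
    case 2
    then show False using three_sun_free_chord[OF sun, of v1 x3 v2 x1 v3 x2] e s n' sym by metis
  next
    case 3
    then show False using C6_free_chord[OF C6, of x1 v3 x2 v1 x3 v2] e s n' sym by metis
  qed
qed

text \<open>
  The Helly property: three members of \<open>C\<close> are left out in turn, and one of the
  three resulting centres must also serve the member that was left out for it.
\<close>

lemma (in pair_graph) square_clique_center:
  assumes free: "\<not> has_induced G three_sun" "\<not> has_induced G (cycle_graph 4)"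
      "\<not> has_induced G (cycle_graph 5)" "\<not> has_induced G (cycle_graph 6)"
    and "finite C" "C \<noteq> {}"
    and "\<And>u v. u \<in> C \<Longrightarrow> v \<in> C \<Longrightarrow> \<exists>z. closed_adj G u z \<and> closed_adj G z v"
  shows "\<exists>x. \<forall>v\<in>C. closed_adj G x v"
  using assms(5-)
proof (induction "card C" arbitrary: C rule: less_induct)
  case less
  show ?case
  proof (cases "\<exists>v1\<in>C. \<exists>v2\<in>C. \<exists>v3\<in>C. v1 \<noteq> v2 \<and> v1 \<noteq> v3 \<and> v2 \<noteq> v3")
    case True
    then obtain v1 v2 v3 where v: "v1 \<in> C" "v2 \<in> C" "v3 \<in> C" "v1 \<noteq> v2" "v1 \<noteq> v3" "v2 \<noteq> v3"
      by blast
    have "\<exists>x. \<forall>w\<in>C - {v}. closed_adj G x w" if "v \<in> C" for v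
    proof (rule less.hyps)
      show "card (C - {v}) < card C" using less.prems(1) that by (rule card_Diff1_less)
      show "C - {v} \<noteq> {}" using v by auto
    qed (use less.prems in auto)
    then obtain x1 x2 x3 where x: "\<forall>w\<in>C - {v1}. closed_adj G x1 w"
      "\<forall>w\<in>C - {v2}. closed_adj G x2 w" "\<forall>w\<in>C - {v3}. closed_adj G x3 w"
      using v by meson
    have "closed_adj G x1 v1 \<or> closed_adj G x2 v2 \<or> closed_adj G x3 v3"
      by (rule closed_adj_triple[OF free]) (use v x in auto)
    then show ?thesis using x by blast
  next
    case False
    obtain u where u: "u \<in> C" using less.prems(2) by blast
    \<comment> \<open>With at most two members, the middle vertex \<open>z\<close> provided by the
      hypothesis for the pair \<open>u\<close>, \<open>v\<close> is already a centre. A singleton is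
      the case \<open>v = u\<close>.\<close>
    have "\<exists>v\<in>C. C \<subseteq> {u, v}"
    proof (cases "C = {u}")
      case True
      then show ?thesis using u by blast
    next
      case False
      then obtain v where "v \<in> C" "v \<noteq> u" using u by blast
      then show ?thesis
        using u \<open>\<not> (\<exists>v1\<in>C. \<exists>v2\<in>C. \<exists>v3\<in>C. v1 \<noteq> v2 \<and> v1 \<noteq> v3 \<and> v2 \<noteq> v3)\<close> by (metis insertCI subsetI)
    qed
    then obtain v where "v \<in> C" "C \<subseteq> {u, v}" by blast
    then show ?thesis using less.prems(3)[OF u, of v] closed_adj_sym by (metis insertE singletonD subsetD)
  qed
qed

text \<open>The middle vertex may coincide with an endpoint, so distances 1 and 2 are treated
  alike.\<close>

lemma (in pair_graph) graph_square_arcs_iff: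
  "(u, v) \<in> parcs (graph_square G) \<longleftrightarrow> u \<noteq> v \<and> (\<exists>z. closed_adj G u z \<and> closed_adj G z v)"
proof
  assume "(u, v) \<in> parcs (graph_square G)"
  then have uv: "u \<noteq> v" "\<mu> (\<lambda>_. 1) u v \<le> 2"
    by (auto simp: graph_square_def graph_dist_def)
  \<comment> \<open>The distance is an infimum over walks, and a strict bound on it yields an actual
    walk below that bound. Lengths are integers, so a cost below 3 still means at most two
    arcs.\<close>
  have "\<mu> (\<lambda>_. 1) u v < 3" using uv(2) by (rule le_less_trans) simp
  then obtain p where p: "awalk u p v" "ereal (awalk_cost (\<lambda>_. 1) p) < 3"
    unfolding \<mu>_def by (auto simp: INF_less_iff)
  have "awalk_cost (\<lambda>_. 1) p = length p" by (induction p) auto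
  with p(2) have "length p < 3" by simp
  moreover have "p \<noteq> []" using p(1) uv(1) by (auto simp: awalk_Nil_iff)
  ultimately consider e where "p = [e]" | e e' where "p = [e, e']"
    by (cases p; cases "tl p"; cases "tl (tl p)") auto
  then show "u \<noteq> v \<and> (\<exists>z. closed_adj G u z \<and> closed_adj G z v)"
  proof cases
    case 1
    then have "closed_adj G u v" "closed_adj G v v"
      using p(1) by (auto simp: awalk_simps closed_adj_def dest: in_arcsD1)
    then show ?thesis using uv(1) by blast
  next
    case 2
    then have "closed_adj G u (snd e)" "closed_adj G (snd e) v"
      using p(1) by (cases e; cases e'; auto simp: awalk_simps closed_adj_def dest: in_arcsD1 in_arcsD2)+
    then show ?thesis using uv(1) by blast
  qed
next
  assume r: "u \<noteq> v \<and> (\<exists>z. closed_adj G u z \<and> closed_adj G z v)"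
  then obtain z where z: "closed_adj G u z" "closed_adj G z v" by blast
  have "\<exists>p. awalk u p v \<and> length p \<le> 2"
  proof -
    consider "u = z" "v = z" | "u = z" "(z, v) \<in> parcs G" | "(u, z) \<in> parcs G" "z = v"
      | "(u, z) \<in> parcs G" "(z, v) \<in> parcs G"
      using z unfolding closed_adj_def by blast
    then show ?thesis
    proof cases
      case 1
      then show ?thesis using r by blast
    next
      case 2
      then show ?thesis using z
        by (intro exI[of _ "[(z, v)]"]) (auto simp: awalk_simps closed_adj_def)
    next
      case 3
      then show ?thesis using z
        by (intro exI[of _ "[(u, z)]"]) (auto simp: awalk_simps closed_adj_def)
    next
      case 4
      then show ?thesis using z
        by (intro exI[of _ "[(u, z), (z, v)]"]) (auto simp: awalk_simps closed_adj_def)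
    qed
  qed
  then obtain p where p: "awalk u p v" "length p \<le> 2" by blast
  have "awalk_cost (\<lambda>_. 1) p = length p" by (induction p) auto
  with min_cost_le_walk_cost[OF p(1), of "\<lambda>_. 1"] p(2) have "\<mu> (\<lambda>_. 1) u v \<le> 2"
    by (auto elim!: order_trans)
  with r z show "(u, v) \<in> parcs (graph_square G)"
    by (auto simp: graph_square_def graph_dist_def closed_adj_def)
qed

lemma pverts_graph_square [simp]: "pverts (graph_square G) = pverts G"
  by (simp add: graph_square_def)

section \<open>Optimal values\<close>

text \<open>The values are natural numbers, so a minimiser of \<open>g\<close> exists once some
  \<open>x\<close> is feasible, and its transform bounds the other minimum. Both equalities of the
  theorem are two uses of this.\<close>

lemma Least_witness_le:
  fixes g :: "'b \<Rightarrow> nat" and h :: "'c \<Rightarrow> nat"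
  assumes "\<exists>x. P x" and "\<And>x. P x \<Longrightarrow> \<exists>y. Q y \<and> h y \<le> g x"
  shows "(LEAST w. \<exists>y. Q y \<and> h y = w) \<le> (LEAST w. \<exists>x. P x \<and> g x = w)"
proof -
  have "\<exists>w x. P x \<and> g x = w" using assms(1) by blast
  from LeastI_ex[OF this] obtain x where x: "P x" "g x = (LEAST w. \<exists>x. P x \<and> g x = w)" by blast
  from assms(2)[OF x(1)] obtain y where y: "Q y" "h y \<le> g x" by blast
  have "(LEAST w. \<exists>y. Q y \<and> h y = w) \<le> h y" using y(1) by (intro Least_le) blast
  with x y show ?thesis by simp
qed

text \<open>A feasible point: its transforms show that order-sensitive dominating sets and clique
  partitions of the square exist.\<close>

lemma roman_dominating_const_1: "roman_dominating G (\<lambda>_. 1)"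
  by (auto simp: roman_dominating_def)

text \<open>Value 2 goes on \<open>A\<close> and value 1 on the rest of \<open>B\<close>. The sets
  may overlap, hence only an upper bound on the weight.\<close>

lemma (in pair_graph) roman_dominating_of_sets:
  assumes "A \<subseteq> pverts G" "B \<subseteq> pverts G"
    and "\<And>v. v \<in> pverts G \<Longrightarrow> v \<in> B \<or> (\<exists>u\<in>A. closed_adj G v u)"
  shows "\<exists>f. roman_dominating G f \<and> (\<Sum>v\<in>pverts G. f v) \<le> 2 * card A + card B"
proof (intro exI conjI)
  let ?f = "\<lambda>v. if v \<in> A then 2 else if v \<in> B then 1 else 0 :: nat"
  show "roman_dominating G ?f"
    using assms by (fastforce simp: roman_dominating_def closed_adj_def)
  have "(\<Sum>v\<in>pverts G. ?f v) \<le> (\<Sum>v\<in>pverts G. 2 * of_bool (v \<in> A) + of_bool (v \<in> B))"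
    by (rule sum_mono) auto
  also have "\<dots> = 2 * card (pverts G \<inter> A) + card (pverts G \<inter> B)"
    using pair_finite_verts
    by (simp add: sum.distrib flip: sum_distrib_left)
  also have "\<dots> = 2 * card A + card B"
    using assms by (simp add: Int_absorb1)
  finally show "(\<Sum>v\<in>pverts G. ?f v) \<le> 2 * card A + card B" .
qed

section \<open>Order-sensitive domination\<close>

text \<open>Each cover raises the level by one and there are only three levels, so at most two
  covers compose.\<close>

lemma P3_le_strict_iff:
  "strictly_below (P3_le G) x y \<longleftrightarrow> (x, y) \<in> P3_cover G \<or> (x, y) \<in> P3_cover G O P3_cover G"
proof
  assume "strictly_below (P3_le G) x y"
  then have "(x, y) \<in> (P3_cover G)\<^sup>*" "x \<noteq> y" by (auto simp: strictly_below_def P3_le_def)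
  moreover have "x = y \<or> (x, y) \<in> P3_cover G \<or> (x, y) \<in> P3_cover G O P3_cover G"
    if "(x, y) \<in> (P3_cover G)\<^sup>*"
    using that
  proof (induction rule: rtrancl_induct)
    case (step y z)
    \<comment> \<open>Two covers would put \<open>y\<close> on level 3 at least, but
      \<open>y\<close> is covered by \<open>z\<close> and so lies on level 2 at most.\<close>
    have "(x, y) \<notin> P3_cover G O P3_cover G"
    proof
      assume "(x, y) \<in> P3_cover G O P3_cover G"
      then have "fst y = fst x + 2" by (auto dest!: P3_cover_level)
      moreover have "fst x \<ge> 1" "fst y \<le> 2"
        using \<open>(x, y) \<in> P3_cover G O P3_cover G\<close> step.hyps(2) by (auto simp: P3_cover_def)
      ultimately show False by simp
    qed
    with step show ?case by blast
  qed simp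
  ultimately show "(x, y) \<in> P3_cover G \<or> (x, y) \<in> P3_cover G O P3_cover G" by blast
next
  assume r: "(x, y) \<in> P3_cover G \<or> (x, y) \<in> P3_cover G O P3_cover G"
  then have "(x, y) \<in> (P3_cover G)\<^sup>*" by (auto intro: rtrancl_trans)
  moreover have "x \<in> P3_ground G" "y \<in> P3_ground G" using r by (auto dest: P3_cover_ground)
  moreover have "fst x < fst y" using r by (auto dest!: P3_cover_level)
  ultimately show "strictly_below (P3_le G) x y" by (auto simp: strictly_below_def P3_le_def)
qed

lemma P3_cover_iff:
  "((l, i), (m, j)) \<in> P3_cover G \<longleftrightarrow> l \<in> {1, 2} \<and> m = l + 1 \<and> closed_adj G i j"
  by (auto simp: P3_cover_def closed_adj_def)

lemma P3_below_mid: "strictly_below (P3_le G) x (2, v) \<longleftrightarrow> (\<exists>u. x = (1, u) \<and> closed_adj G u v)"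
  by (cases x) (auto simp: P3_le_strict_iff P3_cover_iff relcomp_unfold)

lemma P3_above_mid: "strictly_below (P3_le G) (2, v) y \<longleftrightarrow> (\<exists>w. y = (3, w) \<and> closed_adj G v w)"
  by (cases y) (auto simp: P3_le_strict_iff P3_cover_iff relcomp_unfold)

text \<open>One of the two covers keeps the vertex fixed. Only this direction is stated, since
  bottom and top copies of vertices at distance 2 are comparable as well.\<close>

lemma P3_bottom_top: "closed_adj G u v \<Longrightarrow> strictly_below (P3_le G) (1, u) (3, v)"
  by (auto simp: P3_le_strict_iff P3_cover_iff relcomp_unfold closed_adj_def)

lemma P3_Mid: "Mid (P3_ground G) (P3_le G) = {2} \<times> pverts G"
proof -
  have "\<not> strictly_below (P3_le G) x (1, v)" "\<not> strictly_below (P3_le G) (3, v) x" for x v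
    by (cases x; auto simp: P3_le_strict_iff P3_cover_iff relcomp_unfold)+
  then show ?thesis
    by (fastforce simp: Mid_def minimal_elements_def maximal_elements_def P3_ground_def
        P3_below_mid P3_above_mid closed_adj_def)
qed

section \<open>Roman dominating functions against order-sensitive dominating sets\<close>

lemma (in pair_graph) order_sensitive_of_roman:
  assumes f: "roman_dominating G f"
  shows "\<exists>D. (finite D \<and> order_sensitive_dominating_set (P3_ground G) (P3_le G) D) \<and>
    card D \<le> (\<Sum>v\<in>pverts G. f v)"
proof (intro exI conjI)
  let ?A = "{v \<in> pverts G. f v = 2}" and ?B = "{v \<in> pverts G. f v = 1}"
  let ?D = "{1, 3} \<times> ?A \<union> {2} \<times> ?B :: (nat \<times> 'a) set"
  show "finite ?D" using pair_finite_verts by simp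
  have cover: "v \<in> ?B \<or> (\<exists>u\<in>?A. closed_adj G v u \<and> closed_adj G u v)" if v: "v \<in> pverts G" for v
  proof -
    have "f v \<in> {0, 1, 2}" using f v by (auto simp: roman_dominating_def)
    moreover have "\<exists>u\<in>?A. closed_adj G v u \<and> closed_adj G u v" if f0: "f v = 0"
    proof -
      obtain u where "u \<in> pverts G" "(v, u) \<in> parcs G" "f u = 2"
        using f v f0 unfolding roman_dominating_def by blast
      then show ?thesis using v parcs_sym by (auto simp: closed_adj_def)
    qed
    moreover have "closed_adj G v v" using v by (rule closed_adj_refl)
    ultimately show ?thesis using v by blast
  qed
  show "order_sensitive_dominating_set (P3_ground G) (P3_le G) ?D"
    unfolding order_sensitive_dominating_set_def
  proof
    show "dominating_set (Comp (P3_ground G) (P3_le G)) ?D"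
      unfolding dominating_set_def
    proof (intro conjI ballI)
      show "?D \<subseteq> pverts (Comp (P3_ground G) (P3_le G))"
        by (auto simp: Comp_def P3_ground_def)
      fix x assume "x \<in> pverts (Comp (P3_ground G) (P3_le G)) - ?D"
      then have x: "x \<in> P3_ground G" "x \<notin> ?D" by (auto simp: Comp_def)
      then obtain l v where lv: "x = (l, v)" "l \<in> {1, 2, 3}" "v \<in> pverts G"
        by (auto simp: P3_ground_def)
      have "\<exists>y\<in>?D. strictly_below (P3_le G) x y \<or> strictly_below (P3_le G) y x"
      proof (cases "v \<in> ?B")
        case True
        then have D: "(2, v) \<in> ?D" and "l \<noteq> 2" using x lv by auto
        then have "l = 1 \<or> l = 3" using lv by blast
        then have "strictly_below (P3_le G) x (2, v) \<or> strictly_below (P3_le G) (2, v) x"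
          using closed_adj_refl[OF lv(3)] by (auto simp: lv(1) P3_below_mid P3_above_mid)
        then show ?thesis using D by blast
      next
        case False
        then obtain u where u: "u \<in> ?A" "closed_adj G v u" "closed_adj G u v"
          using cover lv by blast
        then have "(1, u) \<in> ?D" "(3, u) \<in> ?D" by auto
        \<comment> \<open>The level of \<open>x\<close> decides: a bottom element lies below
          \<open>(3, u)\<close>, a middle or top one above \<open>(1, u)\<close>.\<close>
        moreover have "strictly_below (P3_le G) x (3, u) \<or> strictly_below (P3_le G) (1, u) x"
          using lv P3_bottom_top[OF u(2)] P3_bottom_top[OF u(3)] P3_below_mid[of G "(1, u)" v] u(3)
          by blast
        ultimately show ?thesis by blast
      qed
      moreover have "?D \<subseteq> P3_ground G" by (auto simp: P3_ground_def)
      ultimately show "\<exists>y\<in>?D. (x, y) \<in> parcs (Comp (P3_ground G) (P3_le G))"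
        using x unfolding Comp_def by auto
    qed
    show "\<forall>x\<in>Mid (P3_ground G) (P3_le G). x \<in> ?D \<or>
      (\<exists>a\<in>?D. \<exists>b\<in>?D. strictly_below (P3_le G) a x \<and> strictly_below (P3_le G) x b)"
    proof
      fix x assume "x \<in> Mid (P3_ground G) (P3_le G)"
      then obtain v where v: "x = (2, v)" "v \<in> pverts G" by (auto simp: P3_Mid)
      show "x \<in> ?D \<or> (\<exists>a\<in>?D. \<exists>b\<in>?D. strictly_below (P3_le G) a x \<and> strictly_below (P3_le G) x b)"
      proof (cases "v \<in> ?B")
        case True
        then show ?thesis using v by simp
      next
        case False
        then obtain u where u: "u \<in> ?A" "closed_adj G v u" "closed_adj G u v"
          using cover v by blast
        then have "strictly_below (P3_le G) (1, u) x" "strictly_below (P3_le G) x (3, u)"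
          by (simp_all add: v P3_below_mid P3_above_mid)
        moreover have "(1, u) \<in> ?D" "(3, u) \<in> ?D" using u by auto
        ultimately show ?thesis by blast
      qed
    qed
  qed
  have "card ?D = card ({1, 3::nat} \<times> ?A) + card ({2::nat} \<times> ?B)"
    using pair_finite_verts by (intro card_Un_disjoint) auto
  also have "\<dots> = (\<Sum>v\<in>?A. f v) + (\<Sum>v\<in>?B. f v)"
    by (simp add: card_cartesian_product)
  also have "\<dots> = (\<Sum>v\<in>?A \<union> ?B. f v)"
    using pair_finite_verts by (intro sum.union_disjoint[symmetric]) auto
  also have "\<dots> \<le> (\<Sum>v\<in>pverts G. f v)"
    using pair_finite_verts by (intro sum_mono2) auto
  finally show "card ?D \<le> (\<Sum>v\<in>pverts G. f v)" .
qed

lemma (in pair_graph) roman_of_order_sensitive: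
  assumes D: "order_sensitive_dominating_set (P3_ground G) (P3_le G) D"
  shows "\<exists>f. roman_dominating G f \<and> (\<Sum>v\<in>pverts G. f v) \<le> card D"
proof -
  define L where "L l = {v. (l, v) \<in> D}" for l :: nat
  have DV: "D \<subseteq> {1, 2, 3} \<times> pverts G"
    using D by (auto simp: order_sensitive_dominating_set_def dominating_set_def Comp_def
        P3_ground_def)
  then have LV: "L l \<subseteq> pverts G" for l by (auto simp: L_def)
  then have fin: "finite (L l)" for l using pair_finite_verts finite_subset by blast
  have "D = (\<Union>l\<in>{1, 2, 3}. {l} \<times> L l)" using DV by (auto simp: L_def)
  moreover have "card (\<Union>l\<in>{1, 2, 3}. {l} \<times> L l) = (\<Sum>l\<in>{1, 2, 3}. card ({l} \<times> L l))"
    using fin by (intro card_UN_disjoint) auto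
  ultimately have cD: "card D = card (L 1) + card (L 2) + card (L 3)"
    by (simp add: card_cartesian_product)
  have L2: "v \<in> L 2 \<or> (\<exists>u\<in>L 1. closed_adj G v u) \<and> (\<exists>u\<in>L 3. closed_adj G v u)"
    if "v \<in> pverts G" for v
  proof -
    have "(2, v) \<in> D \<or> (\<exists>a\<in>D. \<exists>b\<in>D. strictly_below (P3_le G) a (2, v)
        \<and> strictly_below (P3_le G) (2, v) b)"
      using D that by (auto simp: order_sensitive_dominating_set_def P3_Mid)
    then show ?thesis by (auto simp: P3_below_mid P3_above_mid L_def dest: closed_adj_sym)
  qed
  \<comment> \<open>By \<open>L2\<close> either outer level completes \<open>L 2\<close> to a cover.
    The smaller one has at most half of their joint size, so counting it twice costs
    nothing.\<close>
  obtain l where l: "l \<in> {1, 3}" "2 * card (L l) \<le> card (L 1) + card (L 3)"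
  proof (cases "card (L 1) \<le> card (L 3)")
    case True
    then show ?thesis using that[of 1] by simp
  next
    case False
    then show ?thesis using that[of 3] by simp
  qed
  have "\<exists>f. roman_dominating G f \<and> (\<Sum>v\<in>pverts G. f v) \<le> 2 * card (L l) + card (L 2)"
    using LV L2 l(1) by (intro roman_dominating_of_sets) auto
  then show ?thesis using l(2) cD by fastforce
qed

theorem (in pair_graph) gamma_os_P3: "gamma_os (P3_ground G) (P3_le G) = roman_domination_number G"
proof -
  let ?os = "\<lambda>D. finite D \<and> order_sensitive_dominating_set (P3_ground G) (P3_le G) D"
  have ex: "\<exists>D. ?os D"
    using order_sensitive_of_roman[OF roman_dominating_const_1] by blast
  have "(LEAST w. \<exists>D. ?os D \<and> card D = w) = roman_domination_number G"
    unfolding roman_domination_number_def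
  proof (rule antisym)
    show "(LEAST w. \<exists>D. ?os D \<and> card D = w)
        \<le> (LEAST w. \<exists>f. roman_dominating G f \<and> (\<Sum>v\<in>pverts G. f v) = w)"
      by (rule Least_witness_le)
        (use roman_dominating_const_1 in blast, rule order_sensitive_of_roman)
    show "(LEAST w. \<exists>f. roman_dominating G f \<and> (\<Sum>v\<in>pverts G. f v) = w)
        \<le> (LEAST w. \<exists>D. ?os D \<and> card D = w)"
      by (rule Least_witness_le) (use ex roman_of_order_sensitive in blast)+
  qed
  then show ?thesis by (simp add: gamma_os_def conj_assoc)
qed

section \<open>Weighted clique partitions\<close>

text \<open>Fibres over distinct attained values are non-empty and disjoint, hence distinct sets, so
  the weight can be summed over values of \<open>h\<close> instead of cliques.\<close>

lemma clique_partition_fibres: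
  assumes h: "\<And>u v. u \<in> pverts H \<Longrightarrow> v \<in> pverts H \<Longrightarrow> u \<noteq> v \<Longrightarrow> h u = h v \<Longrightarrow> (u, v) \<in> parcs H"
  shows "\<exists>\<C>. clique_partition H \<C> \<and>
    (\<Sum>C\<in>\<C>. clique_weight C) = (\<Sum>w\<in>h ` pverts H. clique_weight {v \<in> pverts H. h v = w})"
proof (intro exI conjI)
  let ?F = "\<lambda>w. {v \<in> pverts H. h v = w}"
  let ?C = "?F ` h ` pverts H"
  show "clique_partition H ?C"
    using h by (auto simp: clique_partition_def clique_def partition_on_def disjoint_def)
  have "inj_on ?F (h ` pverts H)" by (auto simp: inj_on_def)
  then show "(\<Sum>C\<in>?C. clique_weight C) = (\<Sum>w\<in>h ` pverts H. clique_weight (?F w))"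
    by (rule sum.reindex_cong) auto
qed

text \<open>Colour classes of the complement are cliques of \<open>H\<close>. At most
  \<open>k\<close> of them are non-empty, and each weighs at most 2.\<close>

lemma clique_partition_of_coloring:
  assumes c: "proper_coloring (graph_complement H) k c"
  shows "\<exists>\<C>. clique_partition H \<C> \<and> (\<Sum>C\<in>\<C>. clique_weight C) \<le> 2 * k"
proof -
  have "(\<Sum>w\<in>c ` pverts H. clique_weight {v \<in> pverts H. c v = w}) \<le> (\<Sum>w\<in>c ` pverts H. 2)"
    by (rule sum_mono) (simp add: clique_weight_def)
  also have "\<dots> = 2 * card (c ` pverts H)" by simp
  also have "card (c ` pverts H) \<le> card {..<k}"
    using c by (intro card_mono) (auto simp: proper_coloring_def graph_complement_def)
  finally have "(\<Sum>w\<in>c ` pverts H. clique_weight {v \<in> pverts H. c v = w}) \<le> 2 * k" by simp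
  moreover have "(u, v) \<in> parcs H"
    if "u \<in> pverts H" "v \<in> pverts H" "u \<noteq> v" "c u = c v" for u v
    using that c by (auto simp: proper_coloring_def graph_complement_def)
  ultimately show ?thesis using clique_partition_fibres[of H c] by fastforce
qed

lemma weighted_clique_partition_number_le_chromatic:
  assumes fin: "finite (pverts H)"
  shows "weighted_clique_partition_number H \<le> 2 * chromatic_number (graph_complement H)"
proof -
  \<comment> \<open>Giving every vertex its own colour shows that some proper colouring exists, so
    the minimum defining the chromatic number is attained.\<close>
  obtain c :: "'a \<Rightarrow> nat" where "inj_on c (pverts H)" "c ` pverts H = {..<card (pverts H)}"
    using ex_bij_betw_finite_nat[OF fin] by (auto simp: bij_betw_def atLeast0LessThan)
  then have "proper_coloring (graph_complement H) (card (pverts H)) c"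
    by (auto simp: proper_coloring_def graph_complement_def inj_on_def)
  then have "\<exists>k c. proper_coloring (graph_complement H) k c" by blast
  then obtain c where "proper_coloring (graph_complement H) (chromatic_number (graph_complement H)) c"
    using LeastI_ex[of "\<lambda>k. \<exists>c. proper_coloring (graph_complement H) k c"]
    unfolding chromatic_number_def by blast
  from clique_partition_of_coloring[OF this] obtain \<C> where
    C: "clique_partition H \<C>" "(\<Sum>C\<in>\<C>. clique_weight C) \<le> 2 * chromatic_number (graph_complement H)"
    by blast
  have "weighted_clique_partition_number H \<le> (\<Sum>C\<in>\<C>. clique_weight C)"
    unfolding weighted_clique_partition_number_def using C(1) by (intro Least_le) blast
  with C(2) show ?thesis by simp
qed

section \<open>Roman dominating functions against clique partitions of the square\<close>

lemma (in pair_graph) clique_partition_of_roman: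
  assumes f: "roman_dominating G f"
  shows "\<exists>\<C>. clique_partition (graph_square G) \<C> \<and>
    (\<Sum>C\<in>\<C>. clique_weight C) \<le> (\<Sum>v\<in>pverts G. f v)"
proof -
  \<comment> \<open>The map \<open>h\<close> sends a vertex of value 0 to a neighbour of value 2 and
    fixes all others; its fibres will be the cliques.\<close>
  have "\<exists>u. closed_adj G v u \<and> (if f v = 0 then f u = 2 else u = v)" if "v \<in> pverts G" for v
    using f that by (fastforce simp: roman_dominating_def closed_adj_def)
  then obtain h where h: "\<And>v. v \<in> pverts G \<Longrightarrow>
      closed_adj G v (h v) \<and> (if f v = 0 then f (h v) = 2 else h v = v)"
    by metis
  have hV: "h ` pverts G \<subseteq> pverts G" using h by (auto simp: closed_adj_def)
  \<comment> \<open>Vertices of value 0 are never in the image. Only vertices of value 2 attract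
    others, so the fibre over a vertex of value 1 is a singleton of weight 1.\<close>
  have w: "clique_weight {v \<in> pverts G. h v = w} \<le> f w" if w: "w \<in> h ` pverts G" for w
  proof -
    have "w \<in> pverts G" using w hV by blast
    then have "f w \<in> {0, 1, 2}" using f by (auto simp: roman_dominating_def)
    moreover have "f w \<noteq> 0"
    proof -
      obtain v where v: "v \<in> pverts G" "w = h v" using w by blast
      then show ?thesis using h[OF v(1)] by (cases "f v = 0") auto
    qed
    moreover have "{v \<in> pverts G. h v = w} = {w}" if "f w = 1"
    proof -
      have "v = w" if "v \<in> pverts G" "h v = w" for v
        using h[OF that(1)] that(2) \<open>f w = 1\<close> by (auto split: if_splits)
      moreover have "h w = w" using h[OF \<open>w \<in> pverts G\<close>] \<open>f w = 1\<close> by simp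
      ultimately show ?thesis using \<open>w \<in> pverts G\<close> by auto
    qed
    ultimately show ?thesis by (auto simp: clique_weight_def)
  qed
  \<comment> \<open>The common image \<open>h u = h v\<close> is the middle vertex of a walk from
    \<open>u\<close> to \<open>v\<close>.\<close>
  have "(u, v) \<in> parcs (graph_square G)"
    if "u \<in> pverts G" "v \<in> pverts G" "u \<noteq> v" "h u = h v" for u v
    using that h[of u] h[of v] closed_adj_sym unfolding graph_square_arcs_iff by metis
  then obtain \<C> where C: "clique_partition (graph_square G) \<C>"
    "(\<Sum>C\<in>\<C>. clique_weight C) = (\<Sum>w\<in>h ` pverts G. clique_weight {v \<in> pverts G. h v = w})"
    using clique_partition_fibres[of "graph_square G" h] by auto
  note C(2)
  also have "\<dots> \<le> (\<Sum>w\<in>h ` pverts G. f w)" using w by (rule sum_mono)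
  also have "\<dots> \<le> (\<Sum>v\<in>pverts G. f v)" using pair_finite_verts hV by (intro sum_mono2) auto
  finally show ?thesis using C(1) by blast
qed

lemma (in pair_graph) roman_of_clique_partition:
  assumes free: "\<not> has_induced G three_sun" "\<not> has_induced G (cycle_graph 4)"
      "\<not> has_induced G (cycle_graph 5)" "\<not> has_induced G (cycle_graph 6)"
    and C: "clique_partition (graph_square G) \<C>"
  shows "\<exists>f. roman_dominating G f \<and> (\<Sum>v\<in>pverts G. f v) \<le> (\<Sum>C\<in>\<C>. clique_weight C)"
proof -
  have part: "partition_on (pverts G) \<C>" and cl: "\<And>C. C \<in> \<C> \<Longrightarrow> clique (graph_square G) C"
    using C by (auto simp: clique_partition_def)
  have finC: "finite \<C>" using part pair_finite_verts by (rule finite_elements[rotated])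
  have "\<exists>x. \<forall>v\<in>C. closed_adj G x v" if "C \<in> \<C>" for C
  proof (rule square_clique_center[OF free])
    have CV: "C \<subseteq> pverts G" using cl[OF that] by (simp add: clique_def)
    then show "finite C" using pair_finite_verts finite_subset by blast
    show "C \<noteq> {}" using part that by (auto simp: partition_on_def)
    show "\<exists>z. closed_adj G u z \<and> closed_adj G z v" if "u \<in> C" "v \<in> C" for u v
    proof (cases "u = v")
      case True
      have "closed_adj G u u" using CV that by (auto intro: closed_adj_refl)
      then show ?thesis using True by blast
    next
      case False
      then have "(u, v) \<in> parcs (graph_square G)"
        using that cl[OF \<open>C \<in> \<C>\<close>] by (simp add: clique_def)
      then show ?thesis by (simp add: graph_square_arcs_iff)
    qed
  qed
  then obtain x where x: "\<And>C v. C \<in> \<C> \<Longrightarrow> v \<in> C \<Longrightarrow> closed_adj G (x C) v" by metis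
  \<comment> \<open>A clique of weight 2 pays for value 2 on its centre, and a singleton pays for
    value 1 on its only vertex.\<close>
  let ?big = "{C \<in> \<C>. card C \<noteq> 1}" and ?small = "{C \<in> \<C>. card C = 1}"
  let ?B = "{v. {v} \<in> \<C>}"
  have dom: "v \<in> ?B \<or> (\<exists>u\<in>x ` ?big. closed_adj G v u)" if v: "v \<in> pverts G" for v
  proof -
    obtain C where C: "C \<in> \<C>" "v \<in> C" using part v unfolding partition_on_def by blast
    show ?thesis
    proof (cases "card C = 1")
      case True
      then have "C = {v}" using C(2) by (auto simp: card_1_singleton_iff)
      then show ?thesis using C by simp
    next
      case False
      then show ?thesis using C x[OF C] closed_adj_sym by blast
    qed
  qed
  have xV: "x ` ?big \<subseteq> pverts G"
  proof
    fix u assume "u \<in> x ` ?big"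
    then obtain C where "C \<in> \<C>" "u = x C" by blast
    moreover from this obtain v where "v \<in> C" using part by (fastforce simp: partition_on_def)
    ultimately show "u \<in> pverts G" using x by (auto simp: closed_adj_def)
  qed
  have BV: "?B \<subseteq> pverts G" using part by (auto simp: partition_on_def)
  \<comment> \<open>Different cliques may share a centre, which only lowers the weight.\<close>
  have "card (x ` ?big) \<le> card ?big" using finC by (intro card_image_le) simp
  moreover have "card ?B \<le> card ?small"
    using finC by (intro card_inj_on_le[where f = "\<lambda>v. {v}"]) auto
  moreover have "(\<Sum>C\<in>\<C>. clique_weight C) = card ?small + 2 * card ?big"
  proof -
    have "?small = \<C> \<inter> {C. card C = 1}" "?big = \<C> \<inter> - {C. card C = 1}" by auto
    then show ?thesis using finC by (simp only: clique_weight_def sum.If_cases) simp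
  qed
  ultimately show ?thesis
    using roman_dominating_of_sets[OF xV BV dom] by fastforce
qed

theorem corollary33:
  fixes G :: "'a pair_pre_digraph"
  assumes "pair_graph G"
    and "Digraph_Component.connected (with_proj G)"
    and "\<not> has_induced G three_sun"
    and "\<not> has_induced G (cycle_graph 4)"
    and "\<not> has_induced G (cycle_graph 5)"
    and "\<not> has_induced G (cycle_graph 6)"
  shows "gamma_os (P3_ground G) (P3_le G) = roman_domination_number G
    \<and> roman_domination_number G = weighted_clique_partition_number (graph_square G)
    \<and> weighted_clique_partition_number (graph_square G)
        \<le> 2 * chromatic_number (graph_complement (graph_square G))"
proof (intro conjI)
  interpret pair_graph G by fact
  show "gamma_os (P3_ground G) (P3_le G) = roman_domination_number G" by (rule gamma_os_P3)
  show "roman_domination_number G = weighted_clique_partition_number (graph_square G)"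
    unfolding roman_domination_number_def weighted_clique_partition_number_def
  proof (rule antisym; rule Least_witness_le)
    show "\<exists>f. roman_dominating G f" using roman_dominating_const_1 by blast
    show "\<exists>\<C>. clique_partition (graph_square G) \<C>"
      using clique_partition_of_roman[OF roman_dominating_const_1] by blast
  qed (fact roman_of_clique_partition[OF assms(3-6)] clique_partition_of_roman)+
  show "weighted_clique_partition_number (graph_square G)
      \<le> 2 * chromatic_number (graph_complement (graph_square G))"
    using pair_finite_verts by (intro weighted_clique_partition_number_le_chromatic) simp
qed

end
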